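(* Let $\varphi$ be a nonnegative function in $L^1(0,\infty)$, and let $\mathcal H_\varphi$ be the Hausdorff operator generated by $\varphi$, $\mathcal H_\varphi f(x)=\int_0^\infty f\left(\frac{x}{t}\right)\frac{\varphi(t)}{t}\,dt$. Then $$\|\mathcal H_\varphi\|_{H^1(\mathbb R)\to H^1(\mathbb R)}=\int_0^\infty \varphi(t)\,dt.$$
   Context: Fix an arbitrary function $\Phi$ in the Schwartz space $\mathcal S(\mathbb R)$ with $\int_{\mathbb R}\Phi(x)\,dx\neq 0$, and set $\Phi_t(x)=t^{-1}\Phi(x/t)$ for $t>0$. For $f\in L^1(\mathbb R)$ (functions are allowed to be complex-valued), the smooth maximal function is $M_\Phi f(x)=\sup_{t>0}|f*\Phi_t(x)|$, $x\in\mathbb R$. The real Hardy space $H^1(\mathbb R)$ is the space of all $f\in L^1(\mathbb R)$ with $\|f\|_{H^1(\mathbb R)}:=\|M_\Phi f\|_{L^1(\mathbb R)}<\infty$. The space $H^1(\mathbb R)$ does not depend on the choice of $\Phi$ (the norm does). $\|T\|_{H^1(\mathbb R)\to H^1(\mathbb R)}$ denotes the operator norm of $T$ on $(H^1(\mathbb R),\|\cdot\|_{H^1(\mathbb R)})$. *)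

theory Defs
  imports "HOL-Analysis.Analysis"
begin

text \<open>Functions in \<open>L\<^sup>1\<close> are handled through representatives: Lebesgue measurable,
  complex-valued functions on the line, not identified almost everywhere.\<close>

definition schwartz :: "(real \<Rightarrow> complex) set" where
  "schwartz = {\<Phi>. \<forall>n.
     (\<forall>x. ((\<lambda>g y. vector_derivative g (at y)) ^^ n) \<Phi> differentiable (at x)) \<and>
     (\<forall>m. bounded (range (\<lambda>x. x ^ m *\<^sub>R ((\<lambda>g y. vector_derivative g (at y)) ^^ n) \<Phi> x)))}"

definition dilate :: "(real \<Rightarrow> complex) \<Rightarrow> real \<Rightarrow> real \<Rightarrow> complex" where
  "dilate \<Phi> t x = \<Phi> (x / t) / complex_of_real t"

definition convolution :: "(real \<Rightarrow> complex) \<Rightarrow> (real \<Rightarrow> complex) \<Rightarrow> real \<Rightarrow> complex" where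
  "convolution f g x = (LINT y|lebesgue. f y * g (x - y))"

text \<open>Taken in \<^typ>\<open>ennreal\<close>, so that a supremum or an integral that diverges is \<open>\<infinity>\<close>.\<close>

definition smooth_maximal :: "(real \<Rightarrow> complex) \<Rightarrow> (real \<Rightarrow> complex) \<Rightarrow> real \<Rightarrow> ennreal" where
  "smooth_maximal \<Phi> f x = (SUP t\<in>{0<..}. ennreal (cmod (convolution f (dilate \<Phi> t) x)))"

definition H1_norm :: "(real \<Rightarrow> complex) \<Rightarrow> (real \<Rightarrow> complex) \<Rightarrow> ennreal" where
  "H1_norm \<Phi> f = (\<integral>\<^sup>+ x. smooth_maximal \<Phi> f x \<partial>lebesgue)"

definition H1 :: "(real \<Rightarrow> complex) \<Rightarrow> (real \<Rightarrow> complex) set" where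
  "H1 \<Phi> = {f. integrable lebesgue f \<and> H1_norm \<Phi> f < \<infinity>}"

text \<open>Meaningful as an operator norm only for \<open>T\<close> mapping \<^term>\<open>H1 \<Phi>\<close> into itself:
  the formula for \<^const>\<open>H1_norm\<close> returns a junk value on functions outside \<open>L\<^sup>1\<close>.\<close>

definition H1_opnorm ::
    "(real \<Rightarrow> complex) \<Rightarrow> ((real \<Rightarrow> complex) \<Rightarrow> (real \<Rightarrow> complex)) \<Rightarrow> ennreal" where
  "H1_opnorm \<Phi> T = (SUP f\<in>{f \<in> H1 \<Phi>. H1_norm \<Phi> f \<le> 1}. H1_norm \<Phi> (T f))"

text \<open>For \<open>f\<close> and \<open>\<phi>\<close> in \<open>L\<^sup>1\<close> the integral converges absolutely for almost every \<open>x\<close>;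
  at the remaining \<open>x\<close> its value is \<open>0\<close> by the convention of the Bochner integral.\<close>

definition hausdorff_op :: "(real \<Rightarrow> real) \<Rightarrow> (real \<Rightarrow> complex) \<Rightarrow> real \<Rightarrow> complex" where
  "hausdorff_op \<phi> f x = (LINT t:{0<..}|lebesgue. f (x / t) * complex_of_real (\<phi> t / t))"

end

theory Submission
  imports Defs
begin

text \<open>
  Write \<open>A\<close> for the integral of \<open>\<phi>\<close> and \<open>H\<close> for the Hausdorff operator.  For \<open>t > 0\<close> the function
  \<open>f(x/t)/t\<close> has the same \<open>H\<^sup>1\<close> norm as \<open>f\<close>, because dilating \<open>f\<close> only reparametrises
  the family of mollifiers.  Thus \<open>H\<close> is a superposition, with weight \<open>\<phi>(t)\<close>, of isometries, which
  gives the upper bound \<open>A\<close>: by Fubini, the maximal function of \<open>H f\<close> is at most the corresponding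
  superposition of dilates of the maximal function of \<open>f\<close>
  (\<open>maximal_hausdorff_op_le\<close>, \<open>H1_norm_hausdorff_op_le\<close>).

  The bound is sharp because there are functions that are almost invariant under all of these
  isometries at once.  The function \<open>1/x\<close> is exactly invariant, but not in \<open>H\<^sup>1\<close>; its truncation
  \<open>F\<^sub>b\<close> to \<open>1 \<le> |x| \<le> b\<close> is.  Since the maximal function dominates a multiple of \<open>|F\<^sub>b|\<close> away from its jumps, the norm
  of \<open>F\<^sub>b\<close> tends to infinity with \<open>b\<close>, at least like \<open>ln b\<close>
  (\<open>H1_norm_truncated_reciprocal_ge\<close>).  The dilate \<open>F\<^sub>b(x/t)/t\<close> is \<open>1/x\<close> on \<open>t \<le> |x| \<le> b t\<close>, so it
  differs from \<open>F\<^sub>b\<close> only near \<open>|x| = 1\<close> and near \<open>|x| = b\<close>.  If \<open>\<phi>\<close> lives on \<open>[1/n, n]\<close>, then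
  \<open>H F\<^sub>b - A F\<^sub>b\<close> is a sum of two odd functions: one bounded by \<open>A n\<close> and supported in \<open>|x| \<le> n\<close>, one
  bounded by \<open>A n / b\<close> and supported in \<open>|x| \<le> b n\<close>.  A bounded function of compact support and mean
  zero has \<open>H\<^sup>1\<close> norm at most a constant times its bound times the radius of its support
  (\<open>H1_norm_atom_le\<close>), so the norm of the defect is bounded independently of \<open>b\<close>
  (\<open>H1_norm_truncated_reciprocal_defect_le\<close>), hence negligible against the norm of \<open>F\<^sub>b\<close>.  The part
  of \<open>\<phi>\<close> outside \<open>[1/n, n]\<close> is controlled by the upper bound and disappears as \<open>n\<close> grows.

  Fubini needs joint measurability of \<open>(t, x) \<mapsto> f(x/t)\<close>, which is immediate for Borel functions but
  not for Lebesgue measurable ones.  All estimates are therefore proved for Borel functions and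
  \<open>lborel\<close>; replacing \<open>f\<close> and \<open>\<phi>\<close> by Borel representatives changes \<open>H f\<close> at most at the point
  \<open>x = 0\<close> (\<open>hausdorff_op_cong_AE\<close>).
\<close>

section \<open>Borel representatives\<close>

lemma integral_cong_AE_lebesgue:
  fixes f g :: "'a::euclidean_space \<Rightarrow> complex"
  assumes "f \<in> borel_measurable lebesgue" "AE x in lebesgue. f x = g x"
  shows "integral\<^sup>L lebesgue f = integral\<^sup>L lebesgue g"
  using assms borel_measurable_AE[OF assms] by (intro integral_cong_AE) auto

lemma borel_representative:
  fixes f :: "real \<Rightarrow> complex"
  assumes "f \<in> borel_measurable lebesgue"
  obtains g where "g \<in> borel_measurable borel" "AE x in lebesgue. f x = g x"
proof -
  have "(\<lambda>x. Re (f x)) \<in> borel_measurable lebesgue" "(\<lambda>x. Im (f x)) \<in> borel_measurable lebesgue"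
    using assms by measurable
  from this[THEN completion_ex_borel_measurable_real] obtain u v
    where u: "u \<in> borel_measurable lborel" "AE x in lborel. Re (f x) = u x"
      and v: "v \<in> borel_measurable lborel" "AE x in lborel. Im (f x) = v x"
    by blast
  show thesis
  proof (rule that[of "\<lambda>x. Complex (u x) (v x)"])
    show "(\<lambda>x. Complex (u x) (v x)) \<in> borel_measurable borel"
      using u(1) v(1) unfolding Complex_eq by simp
    have "AE x in lborel. f x = Complex (u x) (v x)"
      using u(2) v(2) by eventually_elim (simp add: complex_eq_iff)
    then show "AE x in lebesgue. f x = Complex (u x) (v x)"
      by (rule AE_completion)
  qed
qed

text \<open>The map \<open>t \<mapsto> x/t\<close> is its own inverse and differentiable away from \<open>0\<close>, so it pulls null
  sets back to null sets.\<close>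
lemma AE_lebesgue_divide:
  fixes x :: real
  assumes "AE y in lebesgue. P y" "x \<noteq> 0"
  shows "AE t in lebesgue. 0 < t \<longrightarrow> P (x / t)"
proof -
  have "negligible {y. \<not> P y}"
    using assms(1) by (simp add: completion.AE_iff_null_sets negligible_iff_null_sets)
  then have "negligible ({y. \<not> P y} - {0})"
    by (rule negligible_diff)
  then have "negligible ((\<lambda>y. x / y) ` ({y. \<not> P y} - {0}))"
    by (rule negligible_differentiable_image_negligible[OF order_refl])
       (auto intro!: derivative_intros simp: differentiable_on_def)
  then have "negligible {t. 0 < t \<and> \<not> P (x / t)}"
  proof (rule negligible_subset)
    show "{t. 0 < t \<and> \<not> P (x / t)} \<subseteq> (\<lambda>y. x / y) ` ({y. \<not> P y} - {0})"
    proof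
      fix t assume "t \<in> {t. 0 < t \<and> \<not> P (x / t)}"
      then show "t \<in> (\<lambda>y. x / y) ` ({y. \<not> P y} - {0})"
        using \<open>x \<noteq> 0\<close> by (intro image_eqI[of _ _ "x / t"]) auto
    qed
  qed
  then show ?thesis
    by (simp add: completion.AE_iff_null_sets negligible_iff_null_sets)
qed

lemma hausdorff_op_borel:
  assumes [measurable]: "f \<in> borel_measurable borel" "\<phi> \<in> borel_measurable borel"
    and "\<And>t. t \<le> 0 \<Longrightarrow> \<phi> t = 0"
  shows "hausdorff_op \<phi> f x = (LINT t|lborel. f (x / t) * complex_of_real (\<phi> t / t))"
proof -
  have "hausdorff_op \<phi> f x = (LINT t|lebesgue. f (x / t) * complex_of_real (\<phi> t / t))"
    unfolding hausdorff_op_def set_lebesgue_integral_def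
    using assms(3) by (intro Bochner_Integration.integral_cong) (auto simp: indicator_def not_less)
  also have "\<dots> = (LINT t|lborel. f (x / t) * complex_of_real (\<phi> t / t))"
    by (intro integral_completion) measurable
  finally show ?thesis .
qed

text \<open>The exclusion of \<open>x = 0\<close> is essential: there the integrand involves only the single value
  \<open>f 0\<close>, which an almost everywhere equality does not see.\<close>
lemma hausdorff_op_cong_AE:
  assumes [measurable]: "g \<in> borel_measurable borel" "\<psi> \<in> borel_measurable borel"
    and f: "AE y in lebesgue. f y = g y" and \<phi>: "AE t in lebesgue. 0 < t \<longrightarrow> \<phi> t = \<psi> t"
    and "x \<noteq> 0"
  shows "hausdorff_op \<phi> f x = hausdorff_op \<psi> g x"
  unfolding hausdorff_op_def set_lebesgue_integral_def
proof (rule integral_cong_AE_lebesgue[symmetric])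
  have "(\<lambda>t. indicator {0<..} t *\<^sub>R (g (x / t) * complex_of_real (\<psi> t / t)))
      \<in> borel_measurable lborel"
    by measurable
  then show "(\<lambda>t. indicator {0<..} t *\<^sub>R (g (x / t) * complex_of_real (\<psi> t / t)))
      \<in> borel_measurable lebesgue"
    by (rule measurable_completion)
  show "AE t in lebesgue. indicator {0<..} t *\<^sub>R (g (x / t) * complex_of_real (\<psi> t / t)) =
      indicator {0<..} t *\<^sub>R (f (x / t) * complex_of_real (\<phi> t / t))"
    using AE_lebesgue_divide[OF f \<open>x \<noteq> 0\<close>] \<phi> by eventually_elim (auto simp: indicator_def)
qed

lemma hausdorff_op_scale:
  "hausdorff_op \<phi> (\<lambda>x. c * f x) x = c * hausdorff_op \<phi> f x"
  unfolding hausdorff_op_def set_lebesgue_integral_def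
  by (simp only: integral_mult_right_zero[symmetric] mult.assoc mult_scaleR_right)

lemma convolution_scale:
  "convolution (\<lambda>x. c * f x) g x = c * convolution f g x"
  by (simp add: convolution_def mult.assoc flip: integral_mult_right_zero)

lemma integrable_times_bounded:
  fixes f :: "'a \<Rightarrow> complex"
  assumes f: "integrable M f" and [measurable]: "g \<in> borel_measurable M" and g: "\<And>x. norm (g x) \<le> C"
  shows "integrable M (\<lambda>x. f x * g x)"
proof (rule Bochner_Integration.integrable_bound)
  show "integrable M (\<lambda>x. norm (f x) * C)"
    using f by auto
  show "(\<lambda>x. f x * g x) \<in> borel_measurable M"
    using f by measurable
  have "0 \<le> C" using g[of undefined] norm_ge_zero order_trans by blast
  then show "AE x in M. norm (f x * g x) \<le> norm (norm (f x) * C)"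
    using g by (auto simp: norm_mult intro!: mult_left_mono)
qed

section \<open>The maximal function of an integrable function\<close>

text \<open>All estimates rest on three properties of \<open>\<Phi>\<close>: it is bounded and integrable, and its derivative
  is \<open>O(1/x\<^sup>2)\<close>.\<close>
locale smoothing_kernel =
  fixes \<Phi> :: "real \<Rightarrow> complex"
  assumes schwartz: "\<Phi> \<in> schwartz"
    and integral_nonzero: "(LINT x|lebesgue. \<Phi> x) \<noteq> 0"
begin

definition D\<Phi> :: "real \<Rightarrow> complex" where "D\<Phi> x = vector_derivative \<Phi> (at x)"

lemma kernel_has_derivative: "(\<Phi> has_vector_derivative D\<Phi> x) (at x)"
proof -
  have "\<Phi> differentiable (at x)"
    using schwartz unfolding schwartz_def by (force dest: spec[of _ 0])
  then show ?thesis
    unfolding D\<Phi>_def by (simp add: vector_derivative_works)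
qed

lemma isCont_kernel: "isCont \<Phi> x"
  using kernel_has_derivative has_vector_derivative_continuous by blast

lemma continuous_kernel: "continuous_on S \<Phi>"
  using isCont_kernel continuous_at_imp_continuous_on by blast

lemma measurable_kernel [measurable]: "\<Phi> \<in> borel_measurable borel"
  using continuous_kernel by (rule borel_measurable_continuous_onI)

lemma kernel_bounded: obtains C where "C > 0" "\<And>x. norm (\<Phi> x) \<le> C"
proof -
  have "bounded (range (\<lambda>x. x ^ 0 *\<^sub>R ((\<lambda>g y. vector_derivative g (at y)) ^^ 0) \<Phi> x))"
    using schwartz unfolding schwartz_def by blast
  then have "bounded (range \<Phi>)"
    by simp
  then show thesis
    using that unfolding bounded_pos by auto
qed

definition decay_const :: real where "decay_const = (SUP x. x\<^sup>2 * norm (D\<Phi> x))"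

lemma kernel_derivative_decay: "x\<^sup>2 * norm (D\<Phi> x) \<le> decay_const"
proof -
  have "bounded (range (\<lambda>x. x ^ 2 *\<^sub>R ((\<lambda>g y. vector_derivative g (at y)) ^^ 1) \<Phi> x))"
    using schwartz unfolding schwartz_def by blast
  then have "bounded (range (\<lambda>x. x ^ 2 *\<^sub>R D\<Phi> x))"
    by (simp add: D\<Phi>_def)
  then have "bdd_above (range (\<lambda>x. x\<^sup>2 * norm (D\<Phi> x)))"
    unfolding bounded_pos bdd_above_def by auto
  then show ?thesis
    unfolding decay_const_def by (intro cSUP_upper) auto
qed

lemma decay_const_nonneg: "0 \<le> decay_const"
  using kernel_derivative_decay[of 0] by simp

lemma lebesgue_integral_kernel: "(LINT x|lebesgue. \<Phi> x) = (LINT x|lborel. \<Phi> x)"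
  by (rule integral_completion) measurable

text \<open>The Bochner integral of a function that is not integrable is \<open>0\<close> by convention, so a nonzero
  integral forces integrability.\<close>
lemma integrable_kernel: "integrable lborel \<Phi>"
  using integral_nonzero not_integrable_integral_eq[of lborel \<Phi>]
  unfolding lebesgue_integral_kernel by blast

lemma measurable_dilate [measurable]: "dilate \<Phi> t \<in> borel_measurable borel"
  unfolding dilate_def by measurable

lemma convolution_borel:
  assumes [measurable]: "f \<in> borel_measurable borel"
  shows "convolution f (dilate \<Phi> t) x = (LINT y|lborel. f y * dilate \<Phi> t (x - y))"
  unfolding convolution_def by (rule integral_completion) measurable

lemma dilate_bounded: obtains C where "\<And>x. norm (dilate \<Phi> t x) \<le> C"
proof -
  obtain C where C: "C > 0" "\<And>x. norm (\<Phi> x) \<le> C"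
    using kernel_bounded by blast
  show thesis
    by (rule that[of "C / \<bar>t\<bar>"])
       (auto simp: dilate_def norm_divide intro!: divide_right_mono C)
qed

lemma integrable_convolution:
  assumes "integrable lborel f"
  shows "integrable lborel (\<lambda>y. f y * dilate \<Phi> t (x - y))"
proof -
  obtain C where "\<And>x. norm (dilate \<Phi> t x) \<le> C"
    using dilate_bounded by blast
  then show ?thesis
    by (intro integrable_times_bounded[where C = C] assms) auto
qed

lemma continuous_convolution:
  assumes f: "integrable lborel f"
  shows "continuous_on UNIV (convolution f (dilate \<Phi> t))"
proof (rule continuous_on_sequentiallyI)
  fix u :: "nat \<Rightarrow> real" and a assume u: "u \<longlonglongrightarrow> a"
  have [measurable]: "f \<in> borel_measurable borel"
    using f by (simp add: integrable_iff_bounded)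
  obtain C where C: "\<And>x. norm (dilate \<Phi> t x) \<le> C"
    using dilate_bounded by blast
  have cont: "isCont (dilate \<Phi> t) x" for x
  proof (cases "t = 0")
    case False
    then show ?thesis
      unfolding dilate_def[abs_def] by (intro continuous_intros isCont_o2[OF _ isCont_kernel]) auto
  qed (simp add: dilate_def[abs_def])
  show "(\<lambda>n. convolution f (dilate \<Phi> t) (u n)) \<longlonglongrightarrow> convolution f (dilate \<Phi> t) a"
    unfolding convolution_borel[OF \<open>f \<in> borel_measurable borel\<close>]
  proof (rule integral_dominated_convergence[where w = "\<lambda>y. norm (f y) * C"])
    show "AE y in lborel. (\<lambda>n. f y * dilate \<Phi> t (u n - y)) \<longlonglongrightarrow> f y * dilate \<Phi> t (a - y)"
      by (intro AE_I2 tendsto_intros isCont_tendsto_compose[OF cont] u)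
    show "AE y in lborel. norm (f y * dilate \<Phi> t (u n - y)) \<le> norm (f y) * C" for n
      using C by (auto simp: norm_mult intro!: mult_left_mono)
  qed (use f in auto)
qed

text \<open>A supremum over uncountably many \<open>t\<close>; it is measurable because it is lower semicontinuous,
  as a supremum of continuous functions.\<close>
lemma measurable_maximal:
  assumes "integrable lborel f"
  shows "smooth_maximal \<Phi> f \<in> borel_measurable borel"
proof (rule borel_measurableI_greater)
  fix y
  have "open {x. y < ennreal (cmod (convolution f (dilate \<Phi> t) x))}" for t
    by (intro open_Collect_less continuous_on_const continuous_on_ennreal continuous_on_norm
         continuous_convolution assms)
  then have "open (\<Union>t\<in>{0<..}. {x. y < ennreal (cmod (convolution f (dilate \<Phi> t) x))})"
    by (intro open_UN) auto
  also have "\<dots> = {x \<in> space borel. y < smooth_maximal \<Phi> f x}"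
    by (auto simp: smooth_maximal_def less_SUP_iff)
  finally show "{x \<in> space borel. y < smooth_maximal \<Phi> f x} \<in> sets borel"
    by (rule borel_open)
qed

lemma H1_norm_lborel: "H1_norm \<Phi> f = (\<integral>\<^sup>+ x. smooth_maximal \<Phi> f x \<partial>lborel)"
  unfolding H1_norm_def by (rule nn_integral_completion)

lemma smooth_maximal_scale:
  "smooth_maximal \<Phi> (\<lambda>x. c * f x) x = ennreal (norm c) * smooth_maximal \<Phi> f x"
  unfolding smooth_maximal_def convolution_scale norm_mult SUP_mult_left_ennreal
  by (simp add: ennreal_mult)

lemma H1_norm_scale:
  assumes "integrable lborel f"
  shows "H1_norm \<Phi> (\<lambda>x. c * f x) = ennreal (norm c) * H1_norm \<Phi> f"
  unfolding H1_norm_lborel smooth_maximal_scale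
  using measurable_maximal[OF assms] by (intro nn_integral_cmult) auto

lemma H1_norm_add:
  assumes "integrable lborel f" "integrable lborel g"
  shows "H1_norm \<Phi> (\<lambda>x. f x + g x) \<le> H1_norm \<Phi> f + H1_norm \<Phi> g"
proof -
  have [measurable]: "f \<in> borel_measurable borel" "g \<in> borel_measurable borel"
    using assms by (auto simp: integrable_iff_bounded)
  have "smooth_maximal \<Phi> (\<lambda>x. f x + g x) x \<le> smooth_maximal \<Phi> f x + smooth_maximal \<Phi> g x" for x
    unfolding smooth_maximal_def
  proof (rule SUP_least)
    fix t :: real assume t: "t \<in> {0<..}"
    have "convolution (\<lambda>x. f x + g x) (dilate \<Phi> t) x =
        convolution f (dilate \<Phi> t) x + convolution g (dilate \<Phi> t) x"
      by (simp add: convolution_borel distrib_right integrable_convolution assms)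
    then have "ennreal (cmod (convolution (\<lambda>x. f x + g x) (dilate \<Phi> t) x)) \<le>
        ennreal (cmod (convolution f (dilate \<Phi> t) x)) + ennreal (cmod (convolution g (dilate \<Phi> t) x))"
      by (simp add: norm_triangle_ineq flip: ennreal_plus)
    also have "\<dots> \<le> (SUP t\<in>{0<..}. ennreal (cmod (convolution f (dilate \<Phi> t) x))) +
        (SUP t\<in>{0<..}. ennreal (cmod (convolution g (dilate \<Phi> t) x)))"
      by (intro add_mono SUP_upper t)
    finally show "ennreal (cmod (convolution (\<lambda>x. f x + g x) (dilate \<Phi> t) x)) \<le> \<dots>" .
  qed
  then have "H1_norm \<Phi> (\<lambda>x. f x + g x) \<le>
      (\<integral>\<^sup>+ x. smooth_maximal \<Phi> f x + smooth_maximal \<Phi> g x \<partial>lborel)"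
    unfolding H1_norm_lborel by (rule nn_integral_mono)
  also have "\<dots> = H1_norm \<Phi> f + H1_norm \<Phi> g"
    unfolding H1_norm_lborel
    using measurable_maximal assms by (intro nn_integral_add) auto
  finally show ?thesis .
qed

lemma H1_norm_cong_AE:
  assumes "f \<in> borel_measurable lebesgue" "AE x in lebesgue. f x = g x"
  shows "H1_norm \<Phi> f = H1_norm \<Phi> g"
proof -
  have "convolution f (dilate \<Phi> t) x = convolution g (dilate \<Phi> t) x" for t x
    unfolding convolution_def
  proof (rule integral_cong_AE_lebesgue)
    have "(\<lambda>y. dilate \<Phi> t (x - y)) \<in> borel_measurable lborel"
      by measurable
    then have "(\<lambda>y. dilate \<Phi> t (x - y)) \<in> borel_measurable lebesgue"
      by (rule measurable_completion)
    then show "(\<lambda>y. f y * dilate \<Phi> t (x - y)) \<in> borel_measurable lebesgue"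
      using assms(1) by (intro borel_measurable_times)
  qed (use assms(2) in auto)
  then show ?thesis
    unfolding H1_norm_def smooth_maximal_def by simp
qed

lemma convolution_substitution:
  assumes "f \<in> borel_measurable borel" "t > 0"
  shows "convolution f (dilate \<Phi> t) x = (LINT u|lborel. f (x - t * u) * \<Phi> u)"
proof -
  have "(LINT y|lborel. f y * dilate \<Phi> t (x - y)) =
      \<bar>- t\<bar> *\<^sub>R (LINT u|lborel. f (x + (- t) * u) * dilate \<Phi> t (x - (x + (- t) * u)))"
    using assms(2) by (intro lborel_integral_real_affine) simp
  also have "\<dots> = (LINT u|lborel. t *\<^sub>R (f (x + (- t) * u) * dilate \<Phi> t (x - (x + (- t) * u))))"
    using assms(2) by simp
  also have "\<dots> = (LINT u|lborel. f (x - t * u) * \<Phi> u)"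
    using assms(2) by (intro Bochner_Integration.integral_cong) (auto simp: dilate_def scaleR_conv_of_real)
  finally show ?thesis
    using assms(1) by (simp add: convolution_borel)
qed

text \<open>Convolving a dilate of \<open>f\<close> with a mollifier is convolving \<open>f\<close> with a mollifier of another
  scale.  This is why normalised dilations are isometries of \<open>H\<^sup>1\<close>.\<close>
lemma convolution_dilated_function:
  assumes "f \<in> borel_measurable borel" "s > 0" "t > 0"
  shows "(LINT y|lborel. f (y / t) * dilate \<Phi> s (x - y)) =
    convolution f (dilate \<Phi> (s / t)) (x / t)"
proof -
  have [measurable]: "f \<in> borel_measurable borel" by fact
  have "(LINT y|lborel. f (y / t) * dilate \<Phi> s (x - y)) =
      convolution (\<lambda>y. f (y / t)) (dilate \<Phi> s) x"
    by (rule convolution_borel[symmetric]) measurable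
  also have "\<dots> = (LINT u|lborel. f ((x - s * u) / t) * \<Phi> u)"
    using assms(2) by (intro convolution_substitution) measurable
  also have "\<dots> = (LINT u|lborel. f (x / t - s / t * u) * \<Phi> u)"
    by (simp add: diff_divide_distrib)
  also have "\<dots> = convolution f (dilate \<Phi> (s / t)) (x / t)"
    using assms by (intro convolution_substitution[symmetric]) auto
  finally show ?thesis .
qed

text \<open>The mollifications at scale \<open>t\<close> converge to \<open>f x\<close> times the integral of \<open>\<Phi>\<close> as \<open>t \<rightarrow> 0\<close>.\<close>
lemma maximal_ge_at_continuity_point:
  assumes [measurable]: "f \<in> borel_measurable borel"
    and bound: "\<And>x. norm (f x) \<le> K" and "isCont f x"
  shows "ennreal (norm (f x) * norm (LINT u|lborel. \<Phi> u)) \<le> smooth_maximal \<Phi> f x"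
proof -
  have "(\<lambda>n. LINT u|lborel. f (x - inverse (real (Suc n)) * u) * \<Phi> u)
      \<longlonglongrightarrow> (LINT u|lborel. f x * \<Phi> u)"
  proof (rule integral_dominated_convergence[where w = "\<lambda>u. K * norm (\<Phi> u)"])
    show "AE u in lborel. (\<lambda>n. f (x - inverse (real (Suc n)) * u) * \<Phi> u) \<longlonglongrightarrow> f x * \<Phi> u"
    proof (intro AE_I2 tendsto_intros isCont_tendsto_compose[OF \<open>isCont f x\<close>])
      fix u
      have "(\<lambda>n. x - inverse (real (Suc n)) * u) \<longlonglongrightarrow> x - 0 * u"
        by (intro tendsto_intros LIMSEQ_inverse_real_of_nat)
      then show "(\<lambda>n. x - inverse (real (Suc n)) * u) \<longlonglongrightarrow> x" by simp
    qed
    show "AE u in lborel. norm (f (x - inverse (real (Suc n)) * u) * \<Phi> u) \<le> K * norm (\<Phi> u)" for n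
      by (auto simp: norm_mult intro!: mult_right_mono bound)
  qed (use integrable_kernel in auto)
  then have "(\<lambda>n. ennreal (norm (LINT u|lborel. f (x - inverse (real (Suc n)) * u) * \<Phi> u)))
      \<longlonglongrightarrow> ennreal (norm (LINT u|lborel. f x * \<Phi> u))"
    by (intro tendsto_ennrealI tendsto_norm)
  moreover have "ennreal (norm (LINT u|lborel. f (x - inverse (real (Suc n)) * u) * \<Phi> u))
      \<le> smooth_maximal \<Phi> f x" for n
    unfolding smooth_maximal_def
    by (intro SUP_upper2[of "inverse (real (Suc n))"]) (auto simp: convolution_substitution)
  ultimately have "ennreal (norm (LINT u|lborel. f x * \<Phi> u)) \<le> smooth_maximal \<Phi> f x"
    by (intro LIMSEQ_le_const2) blast+
  then show ?thesis
    by (simp add: norm_mult)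
qed

section \<open>The upper bound\<close>

lemma integrable_hausdorff_integrand:
  assumes f: "integrable lborel f" and \<phi>: "integrable lborel \<phi>"
    and \<phi>0: "\<And>t. t \<le> 0 \<Longrightarrow> \<phi> t = 0"
  shows "integrable (lborel \<Otimes>\<^sub>M lborel) (\<lambda>(t, x). f (x / t) * complex_of_real (\<phi> t / t))"
proof (rule lborel_pair.Fubini_integrable)
  have [measurable]: "f \<in> borel_measurable borel" "\<phi> \<in> borel_measurable borel"
    using f \<phi> by (auto simp: integrable_iff_bounded)
  show "(\<lambda>(t, x). f (x / t) * complex_of_real (\<phi> t / t)) \<in> borel_measurable (lborel \<Otimes>\<^sub>M lborel)"
    by measurable
  have sec: "integrable lborel (\<lambda>x. f (x / t) * complex_of_real (\<phi> t / t))" for t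
  proof (cases "t > 0")
    case True
    then have "integrable lborel (\<lambda>x. f (0 + (1 / t) * x))"
      by (intro lborel_integrable_real_affine f) auto
    then show ?thesis
      by (intro integrable_mult_left) simp
  qed (use \<phi>0 in auto)
  then show "AE t in lborel. integrable lborel (\<lambda>x. case (t, x) of (t, x) \<Rightarrow> f (x / t) * complex_of_real (\<phi> t / t))"
    by simp
  have "(LINT x|lborel. norm (f (x / t) * complex_of_real (\<phi> t / t))) = norm (\<phi> t) * (LINT x|lborel. norm (f x))" for t
  proof (cases "t > 0")
    case True
    have "(LINT x|lborel. norm (f x)) = \<bar>1 / t\<bar> *\<^sub>R (LINT x|lborel. norm (f (0 + 1 / t * x)))"
      using True by (intro lborel_integral_real_affine) auto
    then show ?thesis
      using True by (simp add: norm_mult norm_divide)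
  qed (use \<phi>0 in auto)
  then show "integrable lborel (\<lambda>t. LINT x|lborel. norm (case (t, x) of (t, x) \<Rightarrow> f (x / t) * complex_of_real (\<phi> t / t)))"
    using \<phi> by simp
qed

lemma integrable_hausdorff_op:
  assumes f: "integrable lborel f" and \<phi>: "integrable lborel \<phi>"
    and \<phi>0: "\<And>t. t \<le> 0 \<Longrightarrow> \<phi> t = 0"
  shows "integrable lborel (hausdorff_op \<phi> f)"
proof -
  have "f \<in> borel_measurable borel" "\<phi> \<in> borel_measurable borel"
    using f \<phi> by (auto simp: integrable_iff_bounded)
  then have "hausdorff_op \<phi> f = (\<lambda>x. LINT t|lborel. f (x / t) * complex_of_real (\<phi> t / t))"
    using hausdorff_op_borel \<phi>0 by blast
  then show ?thesis
    using lborel_pair.integrable_snd[OF integrable_hausdorff_integrand[OF assms]] by simp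
qed

text \<open>Fubini moves the convolution inside the integral over \<open>t\<close>, where it acts on a dilate of \<open>f\<close>.\<close>
lemma maximal_hausdorff_op_le:
  assumes f: "integrable lborel f" and \<phi>: "integrable lborel \<phi>"
    and \<phi>0: "\<And>t. t \<le> 0 \<Longrightarrow> \<phi> t = 0" and pos: "\<And>t. 0 \<le> \<phi> t"
  shows "smooth_maximal \<Phi> (hausdorff_op \<phi> f) x \<le>
    (\<integral>\<^sup>+ t. ennreal (\<phi> t / t) * smooth_maximal \<Phi> f (x / t) \<partial>lborel)"
  unfolding smooth_maximal_def[of \<Phi> "hausdorff_op \<phi> f"]
proof (rule SUP_least)
  fix s :: real assume "s \<in> {0<..}"
  then have s: "s > 0" by simp
  have [measurable]: "f \<in> borel_measurable borel" "\<phi> \<in> borel_measurable borel"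
    using f \<phi> by (auto simp: integrable_iff_bounded)
  obtain C where C: "\<And>x. norm (dilate \<Phi> s x) \<le> C"
    using dilate_bounded by blast
  have eq: "hausdorff_op \<phi> f y = (LINT t|lborel. f (y / t) * complex_of_real (\<phi> t / t))" for y
    by (rule hausdorff_op_borel) (use \<phi>0 in auto)
  have "integrable (lborel \<Otimes>\<^sub>M lborel)
      (\<lambda>p. (case p of (t, y) \<Rightarrow> f (y / t) * complex_of_real (\<phi> t / t)) * dilate \<Phi> s (x - snd p))"
    by (rule integrable_times_bounded[where C = C, OF integrable_hausdorff_integrand[OF f \<phi> \<phi>0]])
       (auto simp: C)
  also have "(\<lambda>p. (case p of (t, y) \<Rightarrow> f (y / t) * complex_of_real (\<phi> t / t)) * dilate \<Phi> s (x - snd p)) =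
      (\<lambda>(t, y). f (y / t) * complex_of_real (\<phi> t / t) * dilate \<Phi> s (x - y))"
    by auto
  finally have int: "integrable (lborel \<Otimes>\<^sub>M lborel)
      (\<lambda>(t, y). f (y / t) * complex_of_real (\<phi> t / t) * dilate \<Phi> s (x - y))" .
  have "convolution (hausdorff_op \<phi> f) (dilate \<Phi> s) x =
      (LINT y|lborel. hausdorff_op \<phi> f y * dilate \<Phi> s (x - y))"
    using integrable_hausdorff_op[OF f \<phi> \<phi>0]
    by (intro convolution_borel) (auto simp: integrable_iff_bounded)
  also have "\<dots> = (LINT y|lborel. LINT t|lborel. f (y / t) * complex_of_real (\<phi> t / t) * dilate \<Phi> s (x - y))"
    unfolding eq by (simp only: integral_mult_left_zero)
  also have "\<dots> = (LINT t|lborel. LINT y|lborel. f (y / t) * complex_of_real (\<phi> t / t) * dilate \<Phi> s (x - y))"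
    by (rule lborel_pair.Fubini_integral[OF int])
  finally have "ennreal (norm (convolution (hausdorff_op \<phi> f) (dilate \<Phi> s) x)) \<le>
      (\<integral>\<^sup>+ t. norm (LINT y|lborel. f (y / t) * complex_of_real (\<phi> t / t) * dilate \<Phi> s (x - y)) \<partial>lborel)"
    using integral_norm_bound_ennreal[OF lborel_pair.integrable_fst[OF int]] by simp
  also have "\<dots> \<le> (\<integral>\<^sup>+ t. ennreal (\<phi> t / t) * smooth_maximal \<Phi> f (x / t) \<partial>lborel)"
  proof (rule nn_integral_mono)
    fix t :: real
    show "ennreal (norm (LINT y|lborel. f (y / t) * complex_of_real (\<phi> t / t) * dilate \<Phi> s (x - y)))
        \<le> ennreal (\<phi> t / t) * smooth_maximal \<Phi> f (x / t)"
    proof (cases "t > 0")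
      case True
      have "(LINT y|lborel. f (y / t) * complex_of_real (\<phi> t / t) * dilate \<Phi> s (x - y)) =
          (LINT y|lborel. complex_of_real (\<phi> t / t) * (f (y / t) * dilate \<Phi> s (x - y)))"
        by (simp add: mult_ac)
      also have "\<dots> = complex_of_real (\<phi> t / t) * convolution f (dilate \<Phi> (s / t)) (x / t)"
        using True s by (subst integral_mult_right_zero) (simp add: convolution_dilated_function)
      finally have "ennreal (norm (LINT y|lborel. f (y / t) * complex_of_real (\<phi> t / t) * dilate \<Phi> s (x - y))) =
          ennreal (\<phi> t / t) * ennreal (norm (convolution f (dilate \<Phi> (s / t)) (x / t)))"
        using True pos[of t] by (simp add: norm_mult norm_divide flip: ennreal_mult)
      also have "\<dots> \<le> ennreal (\<phi> t / t) * smooth_maximal \<Phi> f (x / t)"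
        unfolding smooth_maximal_def using True s by (intro mult_left_mono SUP_upper) auto
      finally show ?thesis .
    qed (use \<phi>0 in auto)
  qed
  finally show "ennreal (norm (convolution (hausdorff_op \<phi> f) (dilate \<Phi> s) x)) \<le> \<dots>" .
qed

lemma H1_norm_hausdorff_op_le:
  assumes f: "integrable lborel f" and \<phi>: "integrable lborel \<phi>"
    and \<phi>0: "\<And>t. t \<le> 0 \<Longrightarrow> \<phi> t = 0" and pos: "\<And>t. 0 \<le> \<phi> t"
  shows "H1_norm \<Phi> (hausdorff_op \<phi> f) \<le> ennreal (LINT t|lborel. \<phi> t) * H1_norm \<Phi> f"
proof -
  have [measurable]: "smooth_maximal \<Phi> f \<in> borel_measurable borel" "\<phi> \<in> borel_measurable borel"
    using measurable_maximal[OF f] \<phi> by (auto simp: integrable_iff_bounded)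
  have "H1_norm \<Phi> (hausdorff_op \<phi> f) \<le>
      (\<integral>\<^sup>+ x. \<integral>\<^sup>+ t. ennreal (\<phi> t / t) * smooth_maximal \<Phi> f (x / t) \<partial>lborel \<partial>lborel)"
    unfolding H1_norm_lborel by (intro nn_integral_mono maximal_hausdorff_op_le assms)
  also have "\<dots> = (\<integral>\<^sup>+ t. \<integral>\<^sup>+ x. ennreal (\<phi> t / t) * smooth_maximal \<Phi> f (x / t) \<partial>lborel \<partial>lborel)"
    by (rule lborel_pair.Fubini') measurable
  also have "\<dots> = (\<integral>\<^sup>+ t. ennreal (\<phi> t) * H1_norm \<Phi> f \<partial>lborel)"
  proof (rule nn_integral_cong)
    fix t :: real
    show "(\<integral>\<^sup>+ x. ennreal (\<phi> t / t) * smooth_maximal \<Phi> f (x / t) \<partial>lborel) = ennreal (\<phi> t) * H1_norm \<Phi> f"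
    proof (cases "t > 0")
      case True
      have "(\<integral>\<^sup>+ x. ennreal (\<phi> t / t) * smooth_maximal \<Phi> f (x / t) \<partial>lborel) =
          ennreal (\<phi> t / t) * (ennreal \<bar>t\<bar> * (\<integral>\<^sup>+ x. smooth_maximal \<Phi> f ((0 + t * x) / t) \<partial>lborel))"
        using True by (subst nn_integral_cmult, simp, subst nn_integral_real_affine[where t = 0 and c = t]) auto
      also have "\<dots> = ennreal (\<phi> t / t * t) * H1_norm \<Phi> f"
        using True pos[of t] by (subst ennreal_mult) (auto simp: H1_norm_lborel mult.assoc)
      finally show ?thesis
        using True by simp
    qed (use \<phi>0 in auto)
  qed
  also have "\<dots> = ennreal (LINT t|lborel. \<phi> t) * H1_norm \<Phi> f"
    using \<phi> pos by (simp add: nn_integral_multc nn_integral_eq_integral)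
  finally show ?thesis .
qed

end

section \<open>Bounded functions of compact support and mean zero\<close>

lemma nn_integral_inverse_square_tail:
  assumes "a > (0::real)"
  shows "(\<integral>\<^sup>+ x. ennreal (1 / x\<^sup>2) * indicator {a..} x \<partial>lborel) = ennreal (1 / a)"
proof -
  have "(\<integral>\<^sup>+ x. ennreal (1 / x\<^sup>2) * indicator {a..} x \<partial>lborel) = ennreal (0 - (- 1 / a))"
  proof (rule nn_integral_FTC_atLeast)
    show "DERIV (\<lambda>x. - 1 / x) x :> 1 / x\<^sup>2" if "a \<le> x" for x
      using that assms by (auto intro!: derivative_eq_intros simp: power2_eq_square)
    show "((\<lambda>x::real. - 1 / x) \<longlongrightarrow> 0) at_top"
      by (intro tendsto_divide_0[OF tendsto_const] filterlim_at_top_imp_at_infinity filterlim_ident)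
  qed auto
  then show ?thesis by simp
qed

lemma nn_integral_inverse_square_outside:
  assumes "a > (0::real)"
  shows "(\<integral>\<^sup>+ x. ennreal (1 / x\<^sup>2) * indicator {x. a \<le> \<bar>x\<bar>} x \<partial>lborel) = ennreal (2 / a)"
proof -
  have "(\<integral>\<^sup>+ x. ennreal (1 / x\<^sup>2) * indicator {x. a \<le> \<bar>x\<bar>} x \<partial>lborel) =
      (\<integral>\<^sup>+ x. ennreal (1 / x\<^sup>2) * indicator {a..} x + ennreal (1 / (- x)\<^sup>2) * indicator {a..} (- x) \<partial>lborel)"
    using assms by (intro nn_integral_cong) (auto simp: indicator_def)
  also have "\<dots> = (\<integral>\<^sup>+ x. ennreal (1 / x\<^sup>2) * indicator {a..} x \<partial>lborel) +
      (\<integral>\<^sup>+ x. ennreal (1 / (- x)\<^sup>2) * indicator {a..} (- x) \<partial>lborel)"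
    by (rule nn_integral_add) measurable
  also have "(\<integral>\<^sup>+ x. ennreal (1 / (- x)\<^sup>2) * indicator {a..} (- x) \<partial>lborel) =
      (\<integral>\<^sup>+ x. ennreal (1 / x\<^sup>2) * indicator {a..} x \<partial>lborel)"
    by (subst (2) nn_integral_real_affine[where t = 0 and c = "-1"]) auto
  finally show ?thesis
    using assms by (simp add: nn_integral_inverse_square_tail flip: ennreal_plus)
qed

context smoothing_kernel
begin

text \<open>On the segment between \<open>(x - y)/t\<close> and \<open>x/t\<close> every point has absolute value at least
  \<open>|x|/(2t)\<close>, so the derivative of \<open>\<Phi>\<close> is \<open>O(t\<^sup>2/x\<^sup>2)\<close> there.  This cancels the factor \<open>1/t\<^sup>2\<close> from
  the two rescalings, and the bound is uniform in \<open>t\<close>.\<close>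
lemma dilate_diff_bound:
  assumes t: "t > 0" and y: "\<bar>y\<bar> \<le> R" and x: "2 * R \<le> \<bar>x\<bar>" "x \<noteq> 0"
  shows "norm (dilate \<Phi> t (x - y) - dilate \<Phi> t x) \<le> 4 * decay_const * R / x\<^sup>2"
proof -
  define C where "C = decay_const"
  have C: "x\<^sup>2 * norm (D\<Phi> x) \<le> C" for x
    unfolding C_def by (rule kernel_derivative_decay)
  have C0: "0 \<le> C"
    unfolding C_def by (rule decay_const_nonneg)
  have R0: "0 \<le> R" using y by linarith
  have "norm (\<Phi> ((x - y) / t) - \<Phi> (x / t)) \<le> (4 * C * t\<^sup>2 / x\<^sup>2) * norm ((x - y) / t - x / t)"
  proof (rule differentiable_bound[where S = "cball (x / t) (R / t)" and f' = "\<lambda>z h. h *\<^sub>R D\<Phi> z"])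
    show "(\<Phi> has_derivative (\<lambda>h. h *\<^sub>R D\<Phi> z)) (at z within cball (x / t) (R / t))" for z
      using kernel_has_derivative[of z] has_derivative_at_withinI
      unfolding has_vector_derivative_def by blast
    fix z assume "z \<in> cball (x / t) (R / t)"
    then have "\<bar>x / t - z\<bar> \<le> R / t"
      by (simp add: dist_real_def)
    moreover have "R / t \<le> \<bar>x / t\<bar> / 2"
      using x t by (simp add: field_simps)
    moreover have "\<bar>a\<bar> / 2 \<le> \<bar>z\<bar>" if "\<bar>a - z\<bar> \<le> r" "r \<le> \<bar>a\<bar> / 2" for a r
      using that by linarith
    ultimately have "\<bar>x / t\<bar> / 2 \<le> \<bar>z\<bar>"
      by blast
    then have z: "(\<bar>x / t\<bar> / 2)\<^sup>2 \<le> z\<^sup>2"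
      by (metis abs_ge_zero divide_nonneg_pos power2_abs power_mono zero_less_numeral)
    then have "(\<bar>x / t\<bar> / 2)\<^sup>2 * norm (D\<Phi> z) \<le> C"
      by (meson C mult_right_mono norm_ge_zero order_trans)
    then have "x\<^sup>2 * norm (D\<Phi> z) \<le> 4 * C * t\<^sup>2"
      using t by (simp add: power_divide field_simps)
    then have "norm (D\<Phi> z) \<le> 4 * C * t\<^sup>2 / x\<^sup>2"
      using x by (subst pos_le_divide_eq) (auto simp: mult.commute)
    moreover have "onorm (\<lambda>h. h *\<^sub>R D\<Phi> z) = norm (D\<Phi> z)"
      using onorm_scaleR_left[OF bounded_linear_ident, of "D\<Phi> z"] by (simp add: onorm_id)
    ultimately show "onorm (\<lambda>h. h *\<^sub>R D\<Phi> z) \<le> 4 * C * t\<^sup>2 / x\<^sup>2"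
      by simp
  qed (use t y R0 in \<open>auto simp: dist_real_def diff_divide_distrib divide_right_mono\<close>)
  also have "norm ((x - y) / t - x / t) = \<bar>y\<bar> / t"
    using t by (simp add: diff_divide_distrib)
  also have "(4 * C * t\<^sup>2 / x\<^sup>2) * (\<bar>y\<bar> / t) \<le> (4 * C * t\<^sup>2 / x\<^sup>2) * (R / t)"
    using y t C0 by (intro mult_left_mono divide_right_mono) auto
  finally have "norm (\<Phi> ((x - y) / t) - \<Phi> (x / t)) / t \<le> (4 * C * t\<^sup>2 / x\<^sup>2) * (R / t) / t"
    using t by (intro divide_right_mono) auto
  then show ?thesis
    using t by (simp add: C_def dilate_def norm_divide power2_eq_square flip: diff_divide_distrib)
qed

definition atom_const :: real where
  "atom_const = 4 * (LINT u|lborel. norm (\<Phi> u)) + 8 * decay_const"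

lemma atom_const_nonneg: "0 \<le> atom_const"
  unfolding atom_const_def using decay_const_nonneg by simp

text \<open>For \<open>|x| \<le> 2R\<close> the maximal function is at most \<open>K\<close> times the \<open>L\<^sup>1\<close> norm of \<open>\<Phi>\<close>.
  For \<open>|x| \<ge> 2R\<close> the mean of \<open>g\<close> being zero allows \<open>dilate \<Phi> t x\<close> to be subtracted from
  the kernel, and the previous bound gives decay like \<open>K R\<^sup>2/x\<^sup>2\<close>.\<close>
lemma H1_norm_atom_le:
  assumes gm [measurable]: "g \<in> borel_measurable borel" and R: "R > 0" and K: "K \<ge> 0"
    and gK: "\<And>x. norm (g x) \<le> K" and supp: "\<And>x. \<bar>x\<bar> > R \<Longrightarrow> g x = 0"
    and mean: "(LINT x|lborel. g x) = 0"
  shows "H1_norm \<Phi> g \<le> ennreal (atom_const * K * R)"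
proof -
  define D where "D = decay_const"
  have D0: "0 \<le> D"
    unfolding D_def by (rule decay_const_nonneg)
  define L where "L = (LINT u|lborel. norm (\<Phi> u))"
  have L0: "0 \<le> L" unfolding L_def by simp
  have gbound: "norm (g x) \<le> indicator {- R..R} x * K" for x
    using gK[of x] supp[of x] by (cases "\<bar>x\<bar> > R") (auto simp: indicator_def)
  have g: "integrable lborel g"
  proof (rule Bochner_Integration.integrable_bound)
    show "integrable lborel (\<lambda>x. indicator {- R..R} x * K :: real)"
      by (intro integrable_mult_left integrable_real_indicator) (auto simp: emeasure_lborel_Icc_eq)
    show "AE x in lborel. norm (g x) \<le> norm (indicator {- R..R} x * K)"
      using gbound K by (auto simp: abs_mult)
  qed simp
  have near: "norm (convolution g (dilate \<Phi> t) x) \<le> K * L" if t: "t > 0" for t x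
  proof -
    have "norm (LINT u|lborel. g (x - t * u) * \<Phi> u) \<le> (LINT u|lborel. norm (g (x - t * u) * \<Phi> u))"
      by (rule integral_norm_bound)
    also have "\<dots> \<le> (LINT u|lborel. K * norm (\<Phi> u))"
      using integrable_kernel gK K
      by (intro integral_mono') (auto simp: norm_mult intro!: mult_right_mono)
    finally show ?thesis
      using t by (simp add: convolution_substitution[OF gm] L_def)
  qed
  have far: "norm (convolution g (dilate \<Phi> t) x) \<le> 8 * D * K * R\<^sup>2 / x\<^sup>2"
    if t: "t > 0" and x: "2 * R \<le> \<bar>x\<bar>" for t x
  proof -
    have x0: "x \<noteq> 0" using x R by auto
    have "convolution g (dilate \<Phi> t) x =
        (LINT y|lborel. g y * dilate \<Phi> t (x - y)) - (LINT y|lborel. g y * dilate \<Phi> t x)"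
      using mean by (simp add: convolution_borel)
    also have "\<dots> = (LINT y|lborel. g y * dilate \<Phi> t (x - y) - g y * dilate \<Phi> t x)"
      using g by (intro Bochner_Integration.integral_diff[symmetric] integrable_convolution) auto
    also have "\<dots> = (LINT y|lborel. g y * (dilate \<Phi> t (x - y) - dilate \<Phi> t x))"
      by (simp add: right_diff_distrib)
    finally have "norm (convolution g (dilate \<Phi> t) x) \<le>
        (LINT y|lborel. norm (g y * (dilate \<Phi> t (x - y) - dilate \<Phi> t x)))"
      by simp
    also have "\<dots> \<le> (LINT y|lborel. indicator {- R..R} y * (K * (4 * D * R / x\<^sup>2)))"
    proof (rule integral_mono')
      show "integrable lborel (\<lambda>y. indicator {- R..R} y * (K * (4 * D * R / x\<^sup>2)) :: real)"
        by (intro integrable_mult_left integrable_real_indicator) (auto simp: emeasure_lborel_Icc_eq)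
      show "norm (g y * (dilate \<Phi> t (x - y) - dilate \<Phi> t x)) \<le> indicator {- R..R} y * (K * (4 * D * R / x\<^sup>2))" for y
      proof (cases "\<bar>y\<bar> \<le> R")
        case True
        then have "norm (g y) * norm (dilate \<Phi> t (x - y) - dilate \<Phi> t x) \<le> K * (4 * D * R / x\<^sup>2)"
          using dilate_diff_bound[OF t True x x0, folded D_def] gK K by (intro mult_mono) auto
        then show ?thesis
          using True by (auto simp: norm_mult indicator_def)
      qed (use supp in \<open>auto simp: indicator_def\<close>)
    qed (use K R D0 in \<open>auto intro!: mult_nonneg_nonneg divide_nonneg_nonneg\<close>)
    also have "\<dots> = 8 * D * K * R\<^sup>2 / x\<^sup>2"
      using R by (simp add: power2_eq_square)
    finally show ?thesis .
  qed
  have "smooth_maximal \<Phi> g x \<le> ennreal (K * L) * indicator {- 2 * R..2 * R} x +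
      ennreal (8 * D * K * R\<^sup>2) * (ennreal (1 / x\<^sup>2) * indicator {x. 2 * R \<le> \<bar>x\<bar>} x)" for x
  proof (cases "2 * R \<le> \<bar>x\<bar>")
    case True
    have "smooth_maximal \<Phi> g x \<le> ennreal (8 * D * K * R\<^sup>2 / x\<^sup>2)"
      unfolding smooth_maximal_def using far True by (intro SUP_least ennreal_leI) auto
    also have "\<dots> = ennreal (8 * D * K * R\<^sup>2) * (ennreal (1 / x\<^sup>2) * indicator {x. 2 * R \<le> \<bar>x\<bar>} x)"
      using True D0 K by (simp flip: ennreal_mult)
    also have "\<dots> \<le> ennreal (K * L) * indicator {- 2 * R..2 * R} x + \<dots>"
      by simp
    finally show ?thesis .
  next
    case False
    have "smooth_maximal \<Phi> g x \<le> ennreal (K * L)"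
      unfolding smooth_maximal_def using near by (intro SUP_least ennreal_leI) auto
    then show ?thesis
      using False by (auto simp: indicator_def)
  qed
  then have "H1_norm \<Phi> g \<le> (\<integral>\<^sup>+ x. ennreal (K * L) * indicator {- 2 * R..2 * R} x +
      ennreal (8 * D * K * R\<^sup>2) * (ennreal (1 / x\<^sup>2) * indicator {x. 2 * R \<le> \<bar>x\<bar>} x) \<partial>lborel)"
    unfolding H1_norm_lborel by (rule nn_integral_mono)
  also have "\<dots> = (\<integral>\<^sup>+ x. ennreal (K * L) * indicator {- 2 * R..2 * R} x \<partial>lborel) +
      (\<integral>\<^sup>+ x. ennreal (8 * D * K * R\<^sup>2) * (ennreal (1 / x\<^sup>2) * indicator {x. 2 * R \<le> \<bar>x\<bar>} x) \<partial>lborel)"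
    by (rule nn_integral_add) measurable
  also have "(\<integral>\<^sup>+ x. ennreal (K * L) * indicator {- 2 * R..2 * R} x \<partial>lborel) = ennreal (K * L * (4 * R))"
    using R K L0 by (simp add: nn_integral_cmult_indicator flip: ennreal_mult)
  also have "(\<integral>\<^sup>+ x. ennreal (8 * D * K * R\<^sup>2) * (ennreal (1 / x\<^sup>2) * indicator {x. 2 * R \<le> \<bar>x\<bar>} x) \<partial>lborel) =
      ennreal (8 * D * K * R\<^sup>2) * ennreal (2 / (2 * R))"
    using R by (subst nn_integral_cmult, measurable) (simp add: nn_integral_inverse_square_outside)
  also have "\<dots> = ennreal (8 * D * K * R)"
    using R K D0 by (simp add: power2_eq_square flip: ennreal_mult)
  also have "ennreal (K * L * (4 * R)) + ennreal (8 * D * K * R) = ennreal ((4 * L + 8 * D) * K * R)"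
    using R K D0 L0 by (simp add: algebra_simps flip: ennreal_plus)
  also have "4 * L + 8 * D = atom_const"
    unfolding atom_const_def L_def D_def ..
  finally show ?thesis .
qed

end

section \<open>Truncations of the reciprocal function\<close>

text \<open>The two parameters keep the family closed under normalised dilations: dilating the function
  with parameters \<open>b\<close> and \<open>1\<close> by \<open>t\<close> and dividing by \<open>t\<close> gives the one with parameters \<open>b\<close> and \<open>t\<close>.\<close>
definition truncated_reciprocal :: "real \<Rightarrow> real \<Rightarrow> real \<Rightarrow> complex" where
  "truncated_reciprocal b t x = (if t \<le> \<bar>x\<bar> \<and> \<bar>x\<bar> \<le> b * t then complex_of_real (1 / x) else 0)"

lemma measurable_truncated_reciprocal [measurable]:
  "(\<lambda>t. truncated_reciprocal b t x) \<in> borel_measurable borel"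
  "truncated_reciprocal b t \<in> borel_measurable borel"
  unfolding truncated_reciprocal_def[abs_def] by measurable

lemma truncated_reciprocal_minus: "truncated_reciprocal b t (- x) = - truncated_reciprocal b t x"
  by (simp add: truncated_reciprocal_def)

lemma norm_truncated_reciprocal_le: "norm (truncated_reciprocal b t x) \<le> 1 / \<bar>x\<bar>"
  by (simp add: truncated_reciprocal_def norm_divide)

lemma norm_truncated_reciprocal_le_1: "norm (truncated_reciprocal b 1 x) \<le> 1"
  by (auto simp: truncated_reciprocal_def norm_divide divide_le_eq)

lemma integrable_truncated_reciprocal: "integrable lborel (truncated_reciprocal b 1)"
proof (rule Bochner_Integration.integrable_bound)
  show "integrable lborel (\<lambda>x. indicator {- b..b} x :: real)"
    by (intro integrable_real_indicator) (auto simp: emeasure_lborel_Icc_eq)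
  show "AE x in lborel. norm (truncated_reciprocal b 1 x) \<le> norm (indicator {- b..b} x :: real)"
    using norm_truncated_reciprocal_le_1 by (auto simp: indicator_def truncated_reciprocal_def norm_divide)
qed simp

lemma integral_odd_eq_0:
  fixes g :: "real \<Rightarrow> complex"
  assumes "\<And>x. g (- x) = - g x"
  shows "(LINT x|lborel. g x) = 0"
proof -
  have "(LINT x|lborel. g x) = \<bar>- 1\<bar> *\<^sub>R (LINT x|lborel. g (0 + (- 1) * x))"
    by (rule lborel_integral_real_affine) simp
  also have "\<dots> = - (LINT x|lborel. g x)"
    using assms by simp
  finally show ?thesis by simp
qed

lemma integrable_truncated_reciprocal_times:
  assumes "integrable lborel \<phi>"
  shows "integrable lborel (\<lambda>t. complex_of_real (\<phi> t) * truncated_reciprocal b t x)"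
  by (rule integrable_times_bounded[where C = "1 / \<bar>x\<bar>"])
     (use assms norm_truncated_reciprocal_le in auto)

text \<open>Invariance of \<open>1/x\<close> under normalised dilations: only the truncation depends on \<open>t\<close>.\<close>
lemma hausdorff_op_truncated_reciprocal:
  assumes "\<phi> \<in> borel_measurable borel" and \<phi>0: "\<And>t. t \<le> 0 \<Longrightarrow> \<phi> t = 0"
  shows "hausdorff_op \<phi> (truncated_reciprocal b 1) x =
    (LINT t|lborel. complex_of_real (\<phi> t) * truncated_reciprocal b t x)"
proof -
  have "truncated_reciprocal b 1 (x / t) * complex_of_real (\<phi> t / t) =
      complex_of_real (\<phi> t) * truncated_reciprocal b t x" for t
  proof (cases "t > 0")
    case True
    then show ?thesis
      by (auto simp: truncated_reciprocal_def field_simps)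
  qed (use \<phi>0 in auto)
  then show ?thesis
    using assms by (subst hausdorff_op_borel) auto
qed

lemma truncated_reciprocal_diff_eq_0:
  assumes "n \<ge> 1" "b \<ge> 1" "1 / n \<le> t" "t \<le> n"
    and "\<bar>x\<bar> < 1 / n \<or> n < \<bar>x\<bar> \<and> \<bar>x\<bar> < b / n \<or> b * n < \<bar>x\<bar>"
  shows "truncated_reciprocal b t x = truncated_reciprocal b 1 x"
proof -
  have n: "1 / n \<le> 1" "b / n \<le> b" "b \<le> b * n" "b * t \<le> b * n" "b / n \<le> b * t"
    using assms mult_left_mono[of 1 n b] mult_left_mono[of t n b] mult_left_mono[of "1 / n" t b]
    by (auto simp: field_simps)
  show ?thesis
    using assms(5)
  proof (elim disjE conjE)
    assume "n < \<bar>x\<bar>" "\<bar>x\<bar> < b / n"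
    then have "t \<le> \<bar>x\<bar>" "\<bar>x\<bar> \<le> b * t" "1 \<le> \<bar>x\<bar>" "\<bar>x\<bar> \<le> b"
      using n assms by linarith+
    then show ?thesis by (simp add: truncated_reciprocal_def)
  next
    assume "\<bar>x\<bar> < 1 / n"
    then have "\<not> t \<le> \<bar>x\<bar>" "\<not> 1 \<le> \<bar>x\<bar>"
      using n assms by linarith+
    then show ?thesis by (simp add: truncated_reciprocal_def)
  next
    assume "b * n < \<bar>x\<bar>"
    then have "\<not> \<bar>x\<bar> \<le> b * t" "\<not> \<bar>x\<bar> \<le> b"
      using n assms by linarith+
    then show ?thesis by (simp add: truncated_reciprocal_def)
  qed
qed

context smoothing_kernel
begin

lemma H1_norm_truncated_reciprocal_finite: 
  assumes "b \<ge> 1"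
  shows "H1_norm \<Phi> (truncated_reciprocal b 1) < \<infinity>"
proof -
  have "H1_norm \<Phi> (truncated_reciprocal b 1) \<le> ennreal (atom_const * 1 * b)"
    using assms by (intro H1_norm_atom_le norm_truncated_reciprocal_le_1 integral_odd_eq_0 truncated_reciprocal_minus)
      (auto simp: truncated_reciprocal_def)
  then show ?thesis
    unfolding infinity_ennreal_def by (rule le_less_trans[OF _ ennreal_less_top])
qed

lemma H1_norm_truncated_reciprocal_ge:
  assumes "b \<ge> 1"
  shows "ennreal (norm (LINT u|lborel. \<Phi> u) * ln b) \<le> H1_norm \<Phi> (truncated_reciprocal b 1)"
proof -
  let ?I = "norm (LINT u|lborel. \<Phi> u)"
  have "ennreal (?I * ln b) = (\<integral>\<^sup>+ x. ennreal (?I * (1 / x)) * indicator {1..b} x \<partial>lborel)"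
  proof (subst nn_integral_FTC_Icc[where F = "\<lambda>x. ?I * ln x"])
    show "DERIV (\<lambda>x. ?I * ln x) x :> ?I * (1 / x)" if "x \<in> {1..b}" for x
      using that by (auto intro!: derivative_eq_intros)
  qed (use assms in auto)
  also have "\<dots> \<le> (\<integral>\<^sup>+ x. smooth_maximal \<Phi> (truncated_reciprocal b 1) x \<partial>lborel)"
  proof (rule nn_integral_mono_AE)
    show "AE x in lborel. ennreal (?I * (1 / x)) * indicator {1..b} x
        \<le> smooth_maximal \<Phi> (truncated_reciprocal b 1) x"
      using AE_lborel_singleton[of 1] AE_lborel_singleton[of b]
    proof eventually_elim
      case (elim x)
      show ?case
      proof (cases "1 < x \<and> x < b")
        case True
        then have ev: "eventually (\<lambda>y. y \<in> {1<..<b}) (nhds x)"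
          by (intro eventually_nhds_in_open) auto
        have "isCont (\<lambda>y. complex_of_real (1 / y)) x"
          using True by (intro continuous_intros) auto
        moreover have "eventually (\<lambda>y. complex_of_real (1 / y) = truncated_reciprocal b 1 y) (nhds x)"
          using ev by eventually_elim (auto simp: truncated_reciprocal_def)
        ultimately have "isCont (truncated_reciprocal b 1) x"
          using isCont_cong[of "\<lambda>y. complex_of_real (1 / y)" "truncated_reciprocal b 1" x] by simp
        from maximal_ge_at_continuity_point[OF _ norm_truncated_reciprocal_le_1 this]
        show ?thesis
          using True by (simp add: truncated_reciprocal_def norm_divide mult.commute)
      next
        case False
        then show ?thesis using elim by (auto simp: indicator_def)
      qed
    qed
  qed
  finally show ?thesis by (simp add: H1_norm_lborel)
qed

text \<open>The bound does not depend on \<open>b\<close>: the piece of the defect near \<open>|x| = b\<close> lives at scale \<open>b\<close> but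
  is of size \<open>1/b\<close>, and the estimate for mean zero functions sees only the product of the two.\<close>
lemma H1_norm_truncated_reciprocal_defect_le:
  assumes \<phi>: "integrable lborel \<phi>" and pos: "\<And>t. 0 \<le> \<phi> t" and n: "n \<ge> 1" and b: "b \<ge> 1"
    and supp: "\<And>t. t \<notin> {1 / n..n} \<Longrightarrow> \<phi> t = 0"
  shows "H1_norm \<Phi> (\<lambda>x. hausdorff_op \<phi> (truncated_reciprocal b 1) x -
      complex_of_real (LINT t|lborel. \<phi> t) * truncated_reciprocal b 1 x)
    \<le> ennreal (2 * atom_const * (LINT t|lborel. \<phi> t) * n\<^sup>2)"
proof -
  define A where "A = (LINT t|lborel. \<phi> t)"
  define d where "d = (\<lambda>x. hausdorff_op \<phi> (truncated_reciprocal b 1) x -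
      complex_of_real A * truncated_reciprocal b 1 x)"
  have A0: "0 \<le> A" unfolding A_def using pos by simp
  have \<phi>0: "\<phi> t = 0" if "t \<le> 0" for t
  proof (rule supp)
    have "0 < 1 / n" using n by simp
    then show "t \<notin> {1 / n..n}" using that unfolding atLeastAtMost_iff by linarith
  qed
  have \<phi>m: "\<phi> \<in> borel_measurable borel"
    using \<phi> by (simp add: integrable_iff_bounded)
  have d: "d x = (LINT t|lborel. complex_of_real (\<phi> t) *
      (truncated_reciprocal b t x - truncated_reciprocal b 1 x))" for x
  proof -
    have "complex_of_real A * truncated_reciprocal b 1 x =
        (LINT t|lborel. complex_of_real (\<phi> t) * truncated_reciprocal b 1 x)"
      by (simp add: A_def)
    then have "d x = (LINT t|lborel. complex_of_real (\<phi> t) * truncated_reciprocal b t x) -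
        (LINT t|lborel. complex_of_real (\<phi> t) * truncated_reciprocal b 1 x)"
      unfolding d_def by (simp add: hausdorff_op_truncated_reciprocal[OF \<phi>m \<phi>0])
    also have "\<dots> = (LINT t|lborel. complex_of_real (\<phi> t) * truncated_reciprocal b t x -
        complex_of_real (\<phi> t) * truncated_reciprocal b 1 x)"
      using \<phi> by (intro Bochner_Integration.integral_diff[symmetric]
          integrable_truncated_reciprocal_times integrable_mult_left) auto
    finally show ?thesis
      by (simp add: right_diff_distrib)
  qed
  have d_int: "integrable lborel d"
    unfolding d_def
    by (intro Bochner_Integration.integrable_diff integrable_mult_right
        integrable_hausdorff_op integrable_truncated_reciprocal \<phi> \<phi>0)
  then have [measurable]: "d \<in> borel_measurable borel"
    by (simp add: integrable_iff_bounded)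
  have d_odd: "d (- x) = - d x" for x
  proof -
    have "complex_of_real (\<phi> t) * (truncated_reciprocal b t (- x) - truncated_reciprocal b 1 (- x)) =
        - (complex_of_real (\<phi> t) * (truncated_reciprocal b t x - truncated_reciprocal b 1 x))" for t
      by (simp add: truncated_reciprocal_minus algebra_simps)
    then show ?thesis
      unfolding d by simp
  qed
  have d_le: "norm (d x) \<le> A / \<bar>x\<bar>" for x
  proof -
    have "norm (truncated_reciprocal b t x - truncated_reciprocal b 1 x) \<le> 1 / \<bar>x\<bar>" for t
      by (auto simp: truncated_reciprocal_def norm_divide)
    then have "norm (d x) \<le> (LINT t|lborel. \<phi> t * (1 / \<bar>x\<bar>))"
      unfolding d using \<phi> pos
      by (intro order.trans[OF integral_norm_bound] integral_mono') 
         (auto simp: norm_mult simp del: times_divide_eq_right mult_1_right intro!: mult_left_mono)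
    then show ?thesis by (simp add: A_def)
  qed
  have d_0: "d x = 0" if "\<bar>x\<bar> < 1 / n \<or> n < \<bar>x\<bar> \<and> \<bar>x\<bar> < b / n \<or> b * n < \<bar>x\<bar>" for x
  proof -
    have "complex_of_real (\<phi> t) * (truncated_reciprocal b t x - truncated_reciprocal b 1 x) = 0" for t
      using supp[of t] truncated_reciprocal_diff_eq_0[OF n b _ _ that, of t] by auto
    then show ?thesis unfolding d by (simp only: integral_zero)
  qed
  define p where "p = (\<lambda>x. if \<bar>x\<bar> \<le> n then d x else 0)"
  define q where "q = (\<lambda>x. if \<bar>x\<bar> \<le> n then 0 else d x)"
  have [measurable]: "p \<in> borel_measurable borel" "q \<in> borel_measurable borel"
    unfolding p_def q_def by measurable
  have int: "integrable lborel p" "integrable lborel q"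
    by (rule Bochner_Integration.integrable_bound[OF d_int]; auto simp: p_def q_def)+
  have "H1_norm \<Phi> p \<le> ennreal (atom_const * (A * n) * n)"
  proof (rule H1_norm_atom_le)
    show "norm (p x) \<le> A * n" for x
    proof (cases "\<bar>x\<bar> < 1 / n")
      case True
      then have "p x = 0" using d_0[of x] unfolding p_def by simp
      then show ?thesis using A0 n by simp
    next
      case False
      then have "1 / n \<le> \<bar>x\<bar>" by simp
      moreover have "0 < 1 / n" using n by simp
      ultimately have "0 < \<bar>x\<bar>" "1 / n \<le> \<bar>x\<bar>" by linarith+
      then have "A / \<bar>x\<bar> \<le> A / (1 / n)"
        using A0 n by (intro divide_left_mono mult_pos_pos) auto
      moreover have "norm (p x) \<le> norm (d x)" unfolding p_def by simp
      ultimately show ?thesis using d_le[of x] by simp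
    qed
    show "(LINT x|lborel. p x) = 0"
      by (rule integral_odd_eq_0) (simp add: p_def d_odd)
    show "p x = 0" if "n < \<bar>x\<bar>" for x
      using that unfolding p_def by simp
  qed (use n A0 in auto)
  moreover have "H1_norm \<Phi> q \<le> ennreal (atom_const * (A * (n / b)) * (b * n))"
  proof (rule H1_norm_atom_le)
    show "norm (q x) \<le> A * (n / b)" for x
    proof (cases "\<bar>x\<bar> < b / n")
      case True
      then have "q x = 0" using d_0[of x] unfolding q_def by simp
      then show ?thesis using A0 n b by simp
    next
      case False
      then have "b / n \<le> \<bar>x\<bar>" by simp
      moreover have "0 < b / n" using b n by simp
      ultimately have "0 < \<bar>x\<bar>" "b / n \<le> \<bar>x\<bar>" by linarith+
      then have "A / \<bar>x\<bar> \<le> A / (b / n)"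
        using A0 n b by (intro divide_left_mono mult_pos_pos) auto
      moreover have "norm (q x) \<le> norm (d x)" unfolding q_def by simp
      ultimately show ?thesis using d_le[of x] by simp
    qed
    show "(LINT x|lborel. q x) = 0"
      by (rule integral_odd_eq_0) (simp add: q_def d_odd)
    show "q x = 0" if "b * n < \<bar>x\<bar>" for x
      using that d_0[of x] unfolding q_def by simp
  qed (use n b A0 in auto)
  ultimately have "H1_norm \<Phi> p + H1_norm \<Phi> q \<le>
      ennreal (atom_const * (A * n) * n) + ennreal (atom_const * (A * (n / b)) * (b * n))"
    by (rule add_mono)
  also have "\<dots> = ennreal (atom_const * (A * n) * n + atom_const * (A * (n / b)) * (b * n))"
    using atom_const_nonneg A0 n b by (intro ennreal_plus[symmetric] mult_nonneg_nonneg) auto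
  also have "atom_const * (A * n) * n + atom_const * (A * (n / b)) * (b * n) = 2 * atom_const * A * n\<^sup>2"
    using b by (simp add: power2_eq_square)
  finally have "H1_norm \<Phi> (\<lambda>x. p x + q x) \<le> ennreal (2 * atom_const * A * n\<^sup>2)"
    using H1_norm_add[OF int] by (rule order_trans[rotated])
  also have "(\<lambda>x. p x + q x) = d"
    by (auto simp: p_def q_def)
  finally show ?thesis
    unfolding d_def A_def .
qed

section \<open>The lower bound\<close>

lemma norm_integral_kernel_pos: "norm (LINT u|lborel. \<Phi> u) > 0"
  using integral_nonzero by (simp add: lebesgue_integral_kernel)

text \<open>Split \<open>\<phi> = \<psi> + \<rho>\<close> with \<open>\<psi>\<close> the part on \<open>[1/n, n]\<close>, and let \<open>A\<close> and \<open>B\<close> be the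
  integrals of \<open>\<phi>\<close> and \<open>\<psi>\<close>.  Writing
  \<open>B F = H\<^sub>\<phi> F - (H\<^sub>\<psi> F - B F) - H\<^sub>\<rho> F\<close> for a truncated reciprocal \<open>F\<close> of norm \<open>L\<close> gives
  \<open>B L \<le> N L + K + (A - B) L\<close> with \<open>K\<close> independent of the truncation, while \<open>L\<close> can be
  arbitrarily large.\<close>
lemma integral_le_bound_truncated:
  assumes \<phi>: "integrable lborel \<phi>" and \<phi>0: "\<And>t. t \<le> 0 \<Longrightarrow> \<phi> t = 0" and pos: "\<And>t. 0 \<le> \<phi> t"
    and N: "N \<ge> 0"
    and bound: "\<And>f. integrable lborel f \<Longrightarrow> H1_norm \<Phi> f < \<infinity> \<Longrightarrow>
        H1_norm \<Phi> (hausdorff_op \<phi> f) \<le> ennreal N * H1_norm \<Phi> f"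
    and n: "n \<ge> 1"
  shows "2 * (LINT t|lborel. \<phi> t * indicator {1 / n..n} t) \<le> (LINT t|lborel. \<phi> t) + N"
proof (rule ccontr)
  define \<psi> where "\<psi> = (\<lambda>t. \<phi> t * indicator {1 / n..n} t)"
  define \<rho> where "\<rho> = (\<lambda>t. \<phi> t - \<psi> t)"
  define A where "A = (LINT t|lborel. \<phi> t)"
  define B where "B = (LINT t|lborel. \<psi> t)"
  define I where "I = norm (LINT u|lborel. \<Phi> u)"
  define K where "K = 2 * atom_const * B * n\<^sup>2"
  assume "\<not> 2 * (LINT t|lborel. \<phi> t * indicator {1 / n..n} t) \<le> (LINT t|lborel. \<phi> t) + N"
  then have \<delta>: "2 * B - A - N > 0"
    by (simp add: A_def B_def \<psi>_def)
  have I: "I > 0"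
    unfolding I_def by (rule norm_integral_kernel_pos)
  have \<psi>: "integrable lborel \<psi>"
    unfolding \<psi>_def using \<phi> by (intro integrable_real_mult_indicator) auto
  have \<rho>: "integrable lborel \<rho>"
    unfolding \<rho>_def using \<phi> \<psi> by simp
  have \<psi>_pos: "0 \<le> \<psi> t" and \<rho>_pos: "0 \<le> \<rho> t" and \<psi>0: "t \<le> 0 \<Longrightarrow> \<psi> t = 0" and \<rho>0: "t \<le> 0 \<Longrightarrow> \<rho> t = 0" for t
    using pos[of t] \<phi>0[of t] by (auto simp: \<psi>_def \<rho>_def indicator_def)
  have \<rho>_int: "(LINT t|lborel. \<rho> t) = A - B"
    unfolding \<rho>_def A_def B_def using \<phi> \<psi> by simp
  have B0: "0 \<le> B" and AB: "0 \<le> A - B"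
    unfolding \<rho>_int[symmetric] unfolding B_def using \<psi>_pos \<rho>_pos by simp_all
  have K0: "0 \<le> K"
    unfolding K_def using atom_const_nonneg B0 by simp
  \<comment> \<open>chosen so that the excess \<open>2 * B - A - N\<close> times the lower bound \<open>I * ln b\<close> for the norm of \<open>F\<close>
    is \<open>K + 1\<close>, which is more than the defect bound \<open>K\<close>\<close>
  define b where "b = exp ((K + 1) / ((2 * B - A - N) * I))"
  have b: "b \<ge> 1"
    unfolding b_def using K0 \<delta> I by simp
  define F where "F = truncated_reciprocal b 1"
  have F: "integrable lborel F"
    unfolding F_def by (rule integrable_truncated_reciprocal)
  have fin: "H1_norm \<Phi> F < \<infinity>"
    unfolding F_def by (rule H1_norm_truncated_reciprocal_finite[OF b])
  define L where "L = enn2real (H1_norm \<Phi> F)"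
  have L: "H1_norm \<Phi> F = ennreal L" and L0: "0 \<le> L"
    using fin by (auto simp: L_def)
  have "ennreal (I * ln b) \<le> ennreal L"
    using H1_norm_truncated_reciprocal_ge[OF b] L by (simp add: I_def F_def)
  then have "I * ln b \<le> L"
    using L0 by (simp add: ennreal_le_iff)
  then have "(2 * B - A - N) * (I * ln b) \<le> (2 * B - A - N) * L"
    using \<delta> by (intro mult_left_mono) auto
  moreover have "(2 * B - A - N) * (I * ln b) = K + 1"
    unfolding b_def using \<delta> I by simp
  ultimately have large: "K < (2 * B - A - N) * L"
    by linarith
  define d where "d = (\<lambda>x. hausdorff_op \<psi> F x - complex_of_real B * F x)"
  have d: "H1_norm \<Phi> d \<le> ennreal K"
    unfolding d_def F_def K_def B_def
    by (rule H1_norm_truncated_reciprocal_defect_le[OF \<psi> \<psi>_pos n b]) (auto simp: \<psi>_def)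
  have int: "integrable lborel (hausdorff_op \<phi> F)" "integrable lborel (hausdorff_op \<rho> F)"
      "integrable lborel (hausdorff_op \<psi> F)"
    using integrable_hausdorff_op F \<phi> \<phi>0 \<psi> \<psi>0 \<rho> \<rho>0 by blast+
  then have d_int: "integrable lborel d"
    unfolding d_def using F by simp
  have split: "complex_of_real B * F x = hausdorff_op \<phi> F x + (- 1 * d x + - 1 * hausdorff_op \<rho> F x)" for x
  proof -
    have repr: "hausdorff_op \<theta> F x = (LINT t|lborel. complex_of_real (\<theta> t) * truncated_reciprocal b t x)"
      if "integrable lborel \<theta>" "\<And>t. t \<le> 0 \<Longrightarrow> \<theta> t = 0" for \<theta>
      unfolding F_def using that
      by (intro hausdorff_op_truncated_reciprocal) (auto simp: integrable_iff_bounded)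
    have "hausdorff_op \<phi> F x = (LINT t|lborel. complex_of_real (\<phi> t) * truncated_reciprocal b t x)"
      by (rule repr[OF \<phi> \<phi>0])
    also have "\<dots> = (LINT t|lborel. complex_of_real (\<psi> t) * truncated_reciprocal b t x +
        complex_of_real (\<rho> t) * truncated_reciprocal b t x)"
      by (simp add: \<rho>_def left_diff_distrib)
    also have "\<dots> = hausdorff_op \<psi> F x + hausdorff_op \<rho> F x"
      using \<psi> \<rho> \<psi>0 \<rho>0 by (simp add: repr integrable_truncated_reciprocal_times)
    finally show ?thesis
      unfolding d_def by simp
  qed
  have "ennreal (B * L) = H1_norm \<Phi> (\<lambda>x. complex_of_real B * F x)"
    using B0 L0 by (simp add: H1_norm_scale[OF F] L ennreal_mult)
  also have "\<dots> = H1_norm \<Phi> (\<lambda>x. hausdorff_op \<phi> F x + (- 1 * d x + - 1 * hausdorff_op \<rho> F x))"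
    unfolding split ..
  also have "\<dots> \<le> H1_norm \<Phi> (hausdorff_op \<phi> F) + H1_norm \<Phi> (\<lambda>x. - 1 * d x + - 1 * hausdorff_op \<rho> F x)"
    by (intro H1_norm_add int Bochner_Integration.integrable_add integrable_mult_right d_int)
  also have "\<dots> \<le> H1_norm \<Phi> (hausdorff_op \<phi> F) +
      (H1_norm \<Phi> (\<lambda>x. - 1 * d x) + H1_norm \<Phi> (\<lambda>x. - 1 * hausdorff_op \<rho> F x))"
    by (intro add_left_mono H1_norm_add int integrable_mult_right d_int)
  also have "\<dots> = H1_norm \<Phi> (hausdorff_op \<phi> F) + (H1_norm \<Phi> d + H1_norm \<Phi> (hausdorff_op \<rho> F))"
    unfolding H1_norm_scale[OF d_int] H1_norm_scale[OF int(2)] by simp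
  also have "\<dots> \<le> ennreal N * ennreal L + (ennreal K + ennreal (A - B) * ennreal L)"
    using bound[OF F fin] d H1_norm_hausdorff_op_le[OF F \<rho> \<rho>0 \<rho>_pos]
    unfolding L \<rho>_int by (intro add_mono)
  also have "\<dots> = ennreal (N * L + (K + (A - B) * L))"
    using N L0 K0 AB by (simp add: ennreal_mult)
  finally have "B * L \<le> N * L + (K + (A - B) * L)"
    using N L0 K0 AB by (subst (asm) ennreal_le_iff) auto
  then have "(2 * B - A - N) * L \<le> K"
    by (simp add: algebra_simps)
  then show False
    using large by simp
qed

lemma integral_le_bound_hausdorff_op:
  assumes \<phi>: "integrable lborel \<phi>" and \<phi>0: "\<And>t. t \<le> 0 \<Longrightarrow> \<phi> t = 0" and pos: "\<And>t. 0 \<le> \<phi> t"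
    and N: "N \<ge> 0"
    and bound: "\<And>f. integrable lborel f \<Longrightarrow> H1_norm \<Phi> f < \<infinity> \<Longrightarrow>
        H1_norm \<Phi> (hausdorff_op \<phi> f) \<le> ennreal N * H1_norm \<Phi> f"
  shows "(LINT t|lborel. \<phi> t) \<le> N"
proof -
  have "(\<lambda>k. LINT t|lborel. \<phi> t * indicator {1 / real (Suc k)..real (Suc k)} t)
      \<longlonglongrightarrow> (LINT t|lborel. \<phi> t)"
  proof (rule integral_dominated_convergence[where w = \<phi>])
    show "AE t in lborel. (\<lambda>k. \<phi> t * indicator {1 / real (Suc k)..real (Suc k)} t) \<longlonglongrightarrow> \<phi> t"
    proof (rule AE_I2)
      fix t :: real
      show "(\<lambda>k. \<phi> t * indicator {1 / real (Suc k)..real (Suc k)} t) \<longlonglongrightarrow> \<phi> t"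
      proof (cases "t > 0")
        case True
        have "(\<lambda>k. 1 / real (Suc k)) \<longlonglongrightarrow> 0"
          using LIMSEQ_inverse_real_of_nat by (simp add: inverse_eq_divide)
        then have "\<forall>\<^sub>F k in sequentially. 1 / real (Suc k) < t"
          by (rule order_tendstoD(2)) fact
        moreover have "\<forall>\<^sub>F k in sequentially. t \<le> real k"
          using filterlim_real_sequentially unfolding filterlim_at_top by blast
        ultimately have "\<forall>\<^sub>F k in sequentially. \<phi> t * indicator {1 / real (Suc k)..real (Suc k)} t = \<phi> t"
          by eventually_elim simp
        then show ?thesis
          by (rule tendsto_eventually)
      qed (use \<phi>0 in simp)
    qed
    show "AE t in lborel. norm (\<phi> t * indicator {1 / real (Suc k)..real (Suc k)} t) \<le> \<phi> t" for k
      using pos by (auto simp: indicator_def)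
  qed (use \<phi> in \<open>auto intro!: borel_measurable_times\<close>)
  then have "(\<lambda>k. 2 * (LINT t|lborel. \<phi> t * indicator {1 / real (Suc k)..real (Suc k)} t))
      \<longlonglongrightarrow> 2 * (LINT t|lborel. \<phi> t)"
    by (intro tendsto_intros)
  then have "2 * (LINT t|lborel. \<phi> t) \<le> (LINT t|lborel. \<phi> t) + N"
    by (rule LIMSEQ_le_const2) (auto intro!: exI[of _ 0] integral_le_bound_truncated assms)
  then show ?thesis by simp
qed

end

section \<open>The norm of the Hausdorff operator\<close>

theorem theorem1p1:
  fixes \<Phi> :: "real \<Rightarrow> complex" and \<phi> :: "real \<Rightarrow> real"
  assumes "\<Phi> \<in> schwartz"
    and "(LINT x|lebesgue. \<Phi> x) \<noteq> 0"
    and "set_integrable lebesgue {0<..} \<phi>"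
    and "AE t in lebesgue. 0 < t \<longrightarrow> 0 \<le> \<phi> t"
  shows "(\<forall>f \<in> H1 \<Phi>. hausdorff_op \<phi> f \<in> H1 \<Phi>) \<and>
    H1_opnorm \<Phi> (hausdorff_op \<phi>) = ennreal (LINT t:{0<..}|lebesgue. \<phi> t)"
proof -
  interpret smoothing_kernel \<Phi>
    using assms(1,2) by unfold_locales
  let ?\<phi> = "\<lambda>t. indicator {0<..} t *\<^sub>R \<phi> t"
  have \<phi>: "integrable lebesgue ?\<phi>"
    using assms(3) by (simp add: set_integrable_def)
  then have "?\<phi> \<in> borel_measurable lebesgue"
    by simp
  from completion_ex_borel_measurable_real[OF this] obtain \<eta>
    where \<eta> [measurable]: "\<eta> \<in> borel_measurable lborel" and \<eta>_eq: "AE t in lborel. ?\<phi> t = \<eta> t"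
    by blast
  define \<psi> where "\<psi> t = (if 0 < t then max 0 (\<eta> t) else 0)" for t
  have \<psi>m [measurable]: "\<psi> \<in> borel_measurable borel"
    using \<eta> unfolding \<psi>_def[abs_def] by measurable
  have \<psi>_eq: "AE t in lebesgue. ?\<phi> t = \<psi> t"
    using AE_completion[OF \<eta>_eq] assms(4) by eventually_elim (auto simp: \<psi>_def indicator_def split: if_splits)
  then have \<psi>_eq': "AE t in lebesgue. 0 < t \<longrightarrow> \<phi> t = \<psi> t"
    by eventually_elim (auto simp: indicator_def)
  have \<psi>0: "t \<le> 0 \<Longrightarrow> \<psi> t = 0" and \<psi>_pos: "0 \<le> \<psi> t" for t
    by (auto simp: \<psi>_def)
  have \<psi>m': "\<psi> \<in> borel_measurable lebesgue"
    using \<psi>m by (intro measurable_completion) simp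
  have "integrable lebesgue \<psi>"
    using \<phi> \<psi>_eq \<psi>m' by (subst integrable_cong_AE[of _ _ ?\<phi>]) auto
  then have \<psi>_int: "integrable lborel \<psi>"
    using integrable_completion[of \<psi> lborel] \<psi>m by simp
  define A where "A = (LINT t|lborel. \<psi> t)"
  have A0: "0 \<le> A"
    unfolding A_def using \<psi>_pos by simp
  have "(LINT t:{0<..}|lebesgue. \<phi> t) = (LINT t|lebesgue. \<psi> t)"
    unfolding set_lebesgue_integral_def using \<phi> \<psi>_eq \<psi>m' by (intro integral_cong_AE) auto
  also have "\<dots> = A"
    unfolding A_def by (rule integral_completion) simp
  finally have A: "(LINT t:{0<..}|lebesgue. \<phi> t) = A" .

  have transfer: "integrable lebesgue (hausdorff_op \<phi> f)"
      "H1_norm \<Phi> (hausdorff_op \<phi> f) = H1_norm \<Phi> (hausdorff_op \<psi> g)"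
    if g: "integrable lborel g" and fg: "AE x in lebesgue. f x = g x" for f g
  proof -
    have "AE x in lebesgue. x \<noteq> 0"
      by (rule AE_completion[OF AE_lborel_singleton])
    then have eq: "AE x in lebesgue. hausdorff_op \<psi> g x = hausdorff_op \<phi> f x"
    proof eventually_elim
      case (elim x)
      then show ?case
        using g by (intro hausdorff_op_cong_AE[symmetric] \<psi>m \<psi>_eq' fg) (auto simp: integrable_iff_bounded)
    qed
    have int: "integrable lborel (hausdorff_op \<psi> g)"
      by (intro integrable_hausdorff_op g \<psi>_int \<psi>0)
    then have "integrable lebesgue (hausdorff_op \<psi> g)"
      using integrable_completion[of "hausdorff_op \<psi> g" lborel] by (simp add: integrable_iff_bounded)
    moreover from this have m: "hausdorff_op \<psi> g \<in> borel_measurable lebesgue"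
      by simp
    moreover have "hausdorff_op \<phi> f \<in> borel_measurable lebesgue"
      by (rule borel_measurable_AE[OF m eq])
    ultimately show "integrable lebesgue (hausdorff_op \<phi> f)"
      using integrable_cong_AE[OF _ _ eq] by blast
    show "H1_norm \<Phi> (hausdorff_op \<phi> f) = H1_norm \<Phi> (hausdorff_op \<psi> g)"
      by (rule H1_norm_cong_AE[OF m eq, symmetric])
  qed
  have upper: "integrable lebesgue (hausdorff_op \<phi> f) \<and>
      H1_norm \<Phi> (hausdorff_op \<phi> f) \<le> ennreal A * H1_norm \<Phi> f" if f: "integrable lebesgue f" for f
  proof -
    have fm: "f \<in> borel_measurable lebesgue"
      using f by simp
    obtain g where g: "g \<in> borel_measurable borel" "AE x in lebesgue. f x = g x"
      using borel_representative[OF fm] by blast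
    have gm: "g \<in> borel_measurable lebesgue"
      by (rule borel_measurable_AE[OF fm g(2)])
    have "integrable lebesgue g"
      using integrable_cong_AE[OF fm gm g(2)] f by blast
    then have gi: "integrable lborel g"
      using integrable_completion[of g lborel] g(1) by simp
    show ?thesis
      using transfer[OF gi g(2)] H1_norm_hausdorff_op_le[OF gi \<psi>_int \<psi>0 \<psi>_pos] H1_norm_cong_AE[OF fm g(2)]
      by (simp add: A_def)
  qed
  have "\<forall>f \<in> H1 \<Phi>. hausdorff_op \<phi> f \<in> H1 \<Phi>"
  proof
    fix f assume f: "f \<in> H1 \<Phi>"
    then have "ennreal A * H1_norm \<Phi> f < \<infinity>"
      by (auto simp: H1_def ennreal_mult_less_top)
    then show "hausdorff_op \<phi> f \<in> H1 \<Phi>"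
      using upper[of f] f by (auto simp: H1_def)
  qed
  moreover have "H1_opnorm \<Phi> (hausdorff_op \<phi>) = ennreal A"
  proof (rule antisym)
    show le: "H1_opnorm \<Phi> (hausdorff_op \<phi>) \<le> ennreal A"
      unfolding H1_opnorm_def
    proof (rule SUP_least)
      fix f assume "f \<in> {f \<in> H1 \<Phi>. H1_norm \<Phi> f \<le> 1}"
      then have f: "integrable lebesgue f" "H1_norm \<Phi> f \<le> 1"
        by (auto simp: H1_def)
      have "H1_norm \<Phi> (hausdorff_op \<phi> f) \<le> ennreal A * H1_norm \<Phi> f"
        using upper[OF f(1)] by simp
      also have "\<dots> \<le> ennreal A * 1"
        using f(2) by (rule mult_left_mono) simp
      finally show "H1_norm \<Phi> (hausdorff_op \<phi> f) \<le> ennreal A"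
        by simp
    qed
    define N where "N = enn2real (H1_opnorm \<Phi> (hausdorff_op \<phi>))"
    have N: "H1_opnorm \<Phi> (hausdorff_op \<phi>) = ennreal N"
      unfolding N_def using le le_less_trans[OF le ennreal_less_top] by simp
    have "A \<le> N"
      unfolding A_def
    proof (rule integral_le_bound_hausdorff_op[OF \<psi>_int \<psi>0 \<psi>_pos])
      show "0 \<le> N"
        unfolding N_def by simp
      fix f :: "real \<Rightarrow> complex"
      assume f: "integrable lborel f" and fin: "H1_norm \<Phi> f < \<infinity>"
      define L where "L = enn2real (H1_norm \<Phi> f)"
      have L: "H1_norm \<Phi> f = ennreal L" and L0: "0 \<le> L"
        using fin by (auto simp: L_def)
      show "H1_norm \<Phi> (hausdorff_op \<psi> f) \<le> ennreal N * H1_norm \<Phi> f"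
      proof (cases "L = 0")
        case True
        then show ?thesis
          using H1_norm_hausdorff_op_le[OF f \<psi>_int \<psi>0 \<psi>_pos] by (simp add: L)
      next
        case False
        then have L1: "L > 0" using L0 by simp
        define h where "h = (\<lambda>x. complex_of_real (1 / L) * f x)"
        have h: "integrable lborel h"
          unfolding h_def using f by simp
        then have "integrable lebesgue h"
          using integrable_completion[of h lborel] by (simp add: integrable_iff_bounded)
        moreover have "H1_norm \<Phi> h = 1"
          unfolding h_def H1_norm_scale[OF f] L using L1 by (simp add: norm_divide flip: ennreal_mult)
        ultimately have "h \<in> {f \<in> H1 \<Phi>. H1_norm \<Phi> f \<le> 1}"
          by (simp add: H1_def)
        then have "H1_norm \<Phi> (hausdorff_op \<phi> h) \<le> ennreal N"
          unfolding N[symmetric] H1_opnorm_def by (rule SUP_upper)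
        moreover have "H1_norm \<Phi> (hausdorff_op \<phi> h) = H1_norm \<Phi> (hausdorff_op \<psi> h)"
          by (rule transfer(2)[OF h]) simp
        moreover have "hausdorff_op \<psi> h = (\<lambda>x. complex_of_real (1 / L) * hausdorff_op \<psi> f x)"
          unfolding h_def by (intro ext hausdorff_op_scale)
        moreover have "H1_norm \<Phi> (\<lambda>x. complex_of_real (1 / L) * hausdorff_op \<psi> f x) =
            ennreal (1 / L) * H1_norm \<Phi> (hausdorff_op \<psi> f)"
          using L1 by (subst H1_norm_scale[OF integrable_hausdorff_op[OF f \<psi>_int \<psi>0]])
            (simp_all add: norm_divide)
        ultimately have "ennreal (1 / L) * H1_norm \<Phi> (hausdorff_op \<psi> f) \<le> ennreal N"
          by simp
        then have "ennreal L * (ennreal (1 / L) * H1_norm \<Phi> (hausdorff_op \<psi> f)) \<le> ennreal L * ennreal N"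
          by (rule mult_left_mono) simp
        then show ?thesis
          using L1 by (simp add: L mult.commute flip: mult.assoc ennreal_mult)
      qed
    qed
    then show "ennreal A \<le> H1_opnorm \<Phi> (hausdorff_op \<phi>)"
      unfolding N by (rule ennreal_leI)
  qed
  ultimately show ?thesis
    unfolding A by simp
qed

end
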